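(* Let $n\ge 2$ be an integer. An $F_U$ move can be realized by a finite sequence of $H(n)$-moves and welded Reidemeister moves. That is, if the diagram $W'$ is obtained from the welded link diagram $W$ by a single $F_U$ move, then $W$ can be transformed into $W'$ by a finite sequence of $H(n)$-moves and welded Reidemeister moves.
   Context: Diagrams. A virtual link diagram is a generic immersion of finitely many circles in the plane (considered up to planar isotopy), each of whose finitely many transverse double points is marked either as a classical crossing (with over/under information) or as a virtual crossing (no over/under information). A welded link diagram is a virtual link diagram considered with respect to the welded Reidemeister moves. Forbidden moves. The forbidden move $F_O$ (respectively $F_U$) moves an arc that passes over (respectively under) both strands of a virtual crossing, at two consecutive classical crossings, across that virtual crossing; the arc remains over (respectively under) both strands. Welded Reidemeister moves. The generalized Reidemeister moves are the classical Reidemeister moves R1, R2, R3 (involving only classical crossings), the virtual Reidemeister moves VR1, VR2, VR3 (the same moves with all crossings virtual), and the mixed move VR4 (an arc having two consecutive virtual crossings with the two strands of a classical crossing is moved across that classical crossing). The welded Reidemeister moves are the generalized Reidemeister moves together with $F_O$. All moves may be used in both directions. $H(n)$-move ($n\ge 2$). Let $B$ be a disk in the plane meeting a diagram $D$ in exactly $n$ pairwise disjoint simple arcs with no crossings in $B$, whose $2n$ endpoints $p_1,\dots,p_{2n}$, in cyclic order on $\partial B$, are joined in pairs $p_{2i-1},p_{2i}$ ($1\le i\le n$). The $H(n)$-move replaces these arcs by $n$ pairwise disjoint simple arcs in $B$ joining $p_{2i}$ to $p_{2i+1}$ ($1\le i\le n$, indices mod $2n$), leaving $D$ unchanged outside $B$.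 An $H(n)$-move is required to preserve the number of components of the diagram. The move is performed on the underlying unoriented diagram; it need not preserve orientations outside $B$. *)

theory Defs
  imports Main
begin

section \<open>Virtual link diagrams\<close>

text \<open>
  A diagram in the plane is put in general position with respect to the height coordinate, so that
  its crossings and the local extrema of its curves lie at distinct heights and no strand is
  horizontal at a crossing. Reading upwards, it becomes a finite word of layers. A layer
  \<open>(i, p)\<close> consists of one elementary piece \<open>p\<close> together with vertical strands, exactly \<open>i\<close> of
  which are to the left of \<open>p\<close>. The strands at a given height are numbered from the left,
  starting with 0.

  In \<open>Cross Over\<close> (\<open>Cross Under\<close>) the strand running from the lower left to the upper right is
  the over-strand (the under-strand); \<open>Cross Virtual\<close> is a virtual crossing. \<open>Cup\<close> is a local
  minimum and \<open>Cap\<close> is a local maximum.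
\<close>

datatype crossing = Over | Under | Virtual

datatype piece = Cup | Cap | Cross crossing

type_synonym tangle = "(nat \<times> piece) list"

fun legs_below :: "piece \<Rightarrow> nat" where
  "legs_below Cup = 0"
| "legs_below Cap = 2"
| "legs_below (Cross c) = 2"

fun legs_above :: "piece \<Rightarrow> nat" where
  "legs_above Cup = 2"
| "legs_above Cap = 0"
| "legs_above (Cross c) = 2"

fun is_tangle :: "nat \<Rightarrow> tangle \<Rightarrow> nat \<Rightarrow> bool" where
  "is_tangle m [] n \<longleftrightarrow> m = n"
| "is_tangle m ((i, p) # T) n \<longleftrightarrow>
     i + legs_below p \<le> m \<and> is_tangle (m - legs_below p + legs_above p) T n"

text \<open>The words of closed diagrams have no strands at the bottom and none at the top.\<close>

definition link_word :: "tangle \<Rightarrow> bool" where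
  "link_word D \<longleftrightarrow> is_tangle 0 D 0"

definition shift :: "nat \<Rightarrow> tangle \<Rightarrow> tangle" where
  "shift k T = map (\<lambda>(i, p). (k + i, p)) T"

text \<open>
  A rule relates the contents \<open>T\<close> and \<open>T'\<close> of a disk before and after a modification. In
  \<open>u @ shift k T @ v\<close> the disk has \<open>k\<close> strands on its left and arbitrarily many on its right.
  All modifications may be used in both directions.
\<close>

type_synonym rule = "tangle \<Rightarrow> tangle \<Rightarrow> bool"

definition local_step :: "rule \<Rightarrow> tangle \<Rightarrow> tangle \<Rightarrow> bool" where
  "local_step R D D' \<longleftrightarrow> link_word D \<and> link_word D' \<and>
     (\<exists>u v k T T'. D = u @ shift k T @ v \<and> D' = u @ shift k T' @ v \<and> (R T T' \<or> R T' T))"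


subsection \<open>Planar isotopy\<close>

fun opposite :: "crossing \<Rightarrow> crossing" where
  "opposite Over = Under"
| "opposite Under = Over"
| "opposite Virtual = Virtual"

text \<open>
  A generic planar isotopy meets only three kinds of non-generic height functions: two pieces at
  the same height (\<open>exchange\<close>), a birth or death of two extrema (\<open>zigzag\<close>), and a strand that is
  horizontal at a crossing, that is, a local extremum of one strand being pulled through a
  crossing with another strand (\<open>cap_slide\<close>, \<open>cup_slide\<close>). In the last case the two strands
  interchange their slopes. So the type of a classical crossing changes to the opposite one while
  the strand passing over remains the same.
\<close>

inductive isotopy_rule :: rule where
  exchange: "isotopy_rule [(0, p), (legs_above p + d, q)] [(legs_below p + d, q), (0, p)]"
| zigzag_left: "isotopy_rule [(1, Cup), (0, Cap)] []"
| zigzag_right: "isotopy_rule [(0, Cup), (1, Cap)] []"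
| cap_slide: "isotopy_rule [(1, Cross c), (0, Cap)] [(0, Cross (opposite c)), (1, Cap)]"
| cup_slide: "isotopy_rule [(0, Cup), (1, Cross c)] [(1, Cup), (0, Cross (opposite c))]"

definition isotopic :: "tangle \<Rightarrow> tangle \<Rightarrow> bool" where
  "isotopic D D' \<longleftrightarrow> link_word D \<and> link_word D' \<and> (local_step isotopy_rule)\<^sup>*\<^sup>* D D'"

lemma local_step_sym: "local_step R D D' \<Longrightarrow> local_step R D' D"
  unfolding local_step_def by blast

lemma isotopic_part_equivp: "part_equivp isotopic"
proof (rule part_equivpI)
  show "\<exists>D. isotopic D D"
    by (rule exI[of _ "[]"]) (simp add: isotopic_def link_word_def)
  show "symp isotopic"
    unfolding isotopic_def
    by (rule sympI) (metis local_step_sym sympD sympI symp_rtranclp)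
  show "transp isotopic"
    unfolding isotopic_def by (rule transpI) (meson rtranclp_trans)
qed

text \<open>Virtual link diagrams are considered up to planar isotopy; they are unoriented.\<close>

quotient_type link_diagram = tangle / partial: isotopic
  by (rule isotopic_part_equivp)


subsection \<open>Components\<close>

text \<open>
  The point \<open>(t, j)\<close> lies on the \<open>j\<close>-th strand at the height above the first \<open>t\<close> layers. The
  relation \<open>joined D\<close> connects points by the arcs of the diagram, going straight ahead at all
  crossings.
\<close>

definition width :: "tangle \<Rightarrow> nat" where
  "width T = foldl (\<lambda>w (i, p). w - legs_below p + legs_above p) 0 T"

definition points :: "tangle \<Rightarrow> (nat \<times> nat) set" where
  "points D = {(t, j). t \<le> length D \<and> j < width (take t D)}"

inductive joined :: "tangle \<Rightarrow> nat \<times> nat \<Rightarrow> nat \<times> nat \<Rightarrow> bool" for D where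
  left_of_piece: "t < length D \<Longrightarrow> D ! t = (i, p) \<Longrightarrow> j < i \<Longrightarrow>
    joined D (t, j) (Suc t, j)"
| right_of_piece: "t < length D \<Longrightarrow> D ! t = (i, p) \<Longrightarrow>
    joined D (t, i + legs_below p + j) (Suc t, i + legs_above p + j)"
| cup: "t < length D \<Longrightarrow> D ! t = (i, Cup) \<Longrightarrow>
    joined D (Suc t, i) (Suc t, Suc i)"
| cap: "t < length D \<Longrightarrow> D ! t = (i, Cap) \<Longrightarrow>
    joined D (t, i) (t, Suc i)"
| cross_rising: "t < length D \<Longrightarrow> D ! t = (i, Cross c) \<Longrightarrow>
    joined D (t, i) (Suc t, Suc i)"
| cross_falling: "t < length D \<Longrightarrow> D ! t = (i, Cross c) \<Longrightarrow>
    joined D (t, Suc i) (Suc t, i)"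

definition num_components :: "tangle \<Rightarrow> nat" where
  "num_components D =
     card (points D // {(x, y). x \<in> points D \<and> y \<in> points D \<and> equivclp (joined D) x y})"


section \<open>Moves\<close>

text \<open>
  The two diagrams of three strands any two of which cross once. The strands are numbered 1, 2, 3
  from left to right at the bottom. The crossing of strands 1 and 2 is \<open>a\<close>, that of 1 and 3
  is \<open>b\<close>, and that of 2 and 3 is \<open>c\<close>. At each crossing the strand with the smaller number runs from
  the lower left to the upper right; so \<open>Over\<close> means that this strand is the over-strand.
\<close>

definition triangle :: "crossing \<Rightarrow> crossing \<Rightarrow> crossing \<Rightarrow> tangle" where
  "triangle a b c = [(0, Cross a), (1, Cross b), (0, Cross c)]"

definition triangle' :: "crossing \<Rightarrow> crossing \<Rightarrow> crossing \<Rightarrow> tangle" where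
  "triangle' a b c = [(1, Cross c), (0, Cross b), (1, Cross a)]"

text \<open>The crossing in which the rising strand is at level \<open>x\<close>, the other one at level \<open>y\<close>.\<close>

definition cross_levels :: "nat \<Rightarrow> nat \<Rightarrow> crossing" where
  "cross_levels x y = (if y < x then Over else Under)"

inductive generalized_rule :: rule where
  R1: "c \<noteq> Virtual \<Longrightarrow> generalized_rule [(0, Cup), (0, Cross c)] [(0, Cup)]"
| R2: "c \<noteq> Virtual \<Longrightarrow> generalized_rule [(0, Cross c), (0, Cross (opposite c))] []"
| R3: "distinct [x, y, z] \<Longrightarrow> generalized_rule
    (triangle (cross_levels x y) (cross_levels x z) (cross_levels y z))
    (triangle' (cross_levels x y) (cross_levels x z) (cross_levels y z))"
| VR1: "generalized_rule [(0, Cup), (0, Cross Virtual)] [(0, Cup)]"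
| VR2: "generalized_rule [(0, Cross Virtual), (0, Cross Virtual)] []"
| VR3: "generalized_rule (triangle Virtual Virtual Virtual) (triangle' Virtual Virtual Virtual)"
| VR4_strand1: "c \<noteq> Virtual \<Longrightarrow>
    generalized_rule (triangle Virtual Virtual c) (triangle' Virtual Virtual c)"
| VR4_strand2: "c \<noteq> Virtual \<Longrightarrow>
    generalized_rule (triangle Virtual c Virtual) (triangle' Virtual c Virtual)"
| VR4_strand3: "c \<noteq> Virtual \<Longrightarrow>
    generalized_rule (triangle c Virtual Virtual) (triangle' c Virtual Virtual)"

text \<open>The names of the cases tell which strand passes over (under) the other two.\<close>

inductive F_O_rule :: rule where
  strand1: "F_O_rule (triangle Over Over Virtual) (triangle' Over Over Virtual)"
| strand2: "F_O_rule (triangle Under Virtual Over) (triangle' Under Virtual Over)"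
| strand3: "F_O_rule (triangle Virtual Under Under) (triangle' Virtual Under Under)"

inductive F_U_rule :: rule where
  strand1: "F_U_rule (triangle Under Under Virtual) (triangle' Under Under Virtual)"
| strand2: "F_U_rule (triangle Over Virtual Under) (triangle' Over Virtual Under)"
| strand3: "F_U_rule (triangle Virtual Over Over) (triangle' Virtual Over Over)"

text \<open>
  The disk of an \<open>H(n)\<close>-move is isotoped so that its \<open>2n\<close> endpoints are at the bottom, in their
  cyclic order. On one side there are \<open>n\<close> caps next to each other. On the other side \<open>n - 1\<close>
  caps next to each other join the endpoints number \<open>2i\<close> and \<open>2i + 1\<close> for \<open>1 \<le> i < n\<close>, and one
  cap above them joins the last endpoint to the first one.
\<close>

inductive H_rule :: "nat \<Rightarrow> rule" for n where
  "H_rule n (replicate n (0, Cap)) (replicate (n - 1) (1, Cap) @ [(0, Cap)])"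

definition diagram_move :: "rule \<Rightarrow> link_diagram \<Rightarrow> link_diagram \<Rightarrow> bool" where
  "diagram_move R W W' \<longleftrightarrow> (\<exists>D D'. W = abs_link_diagram D \<and> W' = abs_link_diagram D' \<and>
     local_step R D D')"

definition F_U_move :: "link_diagram \<Rightarrow> link_diagram \<Rightarrow> bool" where
  "F_U_move W W' \<longleftrightarrow> diagram_move F_U_rule W W'"

definition welded_move :: "link_diagram \<Rightarrow> link_diagram \<Rightarrow> bool" where
  "welded_move W W' \<longleftrightarrow> diagram_move generalized_rule W W' \<or> diagram_move F_O_rule W W'"

definition H_move :: "nat \<Rightarrow> link_diagram \<Rightarrow> link_diagram \<Rightarrow> bool" where
  "H_move n W W' \<longleftrightarrow> (\<exists>D D'. W = abs_link_diagram D \<and> W' = abs_link_diagram D' \<and>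
     local_step (H_rule n) D D' \<and> num_components D = num_components D')"

end

theory Submission
  imports Defs
begin

text \<open>
  The idea is that an \<open>H(2)\<close>-move which preserves the number of components can reverse a segment of
  a strand: cut a strand into consecutive segments \<open>X\<close>, \<open>Y\<close>, \<open>Z\<close>, bring the two ends of \<open>Y\<close> next
  to each other by virtual crossings, and reconnect so that \<open>Y\<close> is traversed backwards
  (\<open>strand_reversal\<close>). Only one strand is involved, so that no component is split or merged,
  whatever components the other strands belong to.

  In an \<open>F_U\<close> move an arc passes under two strands \<open>A\<close> and \<open>B\<close>. Moving the arc across the virtual
  crossing of \<open>A\<close> and \<open>B\<close> means, up to virtual detours, to exchange its two consecutive
  undercrossings. Reversing the segment with both of them (\<open>reverse_under_two\<close>) puts them in the
  opposite order, but the arc now passes under \<open>A\<close> and under \<open>B\<close> from the wrong sides. Reversing the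
  segment of each undercrossing separately (\<open>reverse_under_one\<close>) corrects this. The calculation
  is \<open>F_U_strand1\<close>; the cases in which the arc has another position among the three strands follow
  from it, because \<open>reverse_under_one\<close> also expresses each \<open>Over\<close> crossing by an \<open>Under\<close> crossing
  between two virtual ones.

  For \<open>n > 2\<close> the \<open>H(2)\<close>-moves are special cases of \<open>H(n)\<close>-moves: a virtual kink on one of the arcs
  supplies an additional arc (\<open>H_smaller_interchangeable\<close>).

  It has to be shown that the moves preserve the number of components. A diagram
  with \<open>m\<close> components has \<open>2 ^ m\<close> colourings of its components with two colours, and these are
  counted layer by layer (\<open>colourings_num_components\<close>). This reduces the condition to a calculation
  inside the disk.
\<close>

section \<open>Counting components by 2-colourings\<close>

text \<open>
  The number of components changes under a local modification in a way that is awkward to follow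
  along paths. Colour each component with one of two colours instead: there are \<open>2\<close> to the number of
  components many colourings, and they can be counted layer by layer, so that a modification inside
  a disk is controlled by what it does to the colours on the boundary of the disk. A list \<open>c\<close> of
  booleans gives the colours of the strands at one height; \<open>successors l c\<close> lists the
  colours that are then possible above the layer \<open>l\<close>.
\<close>

fun successors :: "nat \<times> piece \<Rightarrow> bool list \<Rightarrow> bool list list" where
  "successors (i, Cup) c = [take i c @ [False, False] @ drop i c, take i c @ [True, True] @ drop i c]"
| "successors (i, Cap) c = (if c ! i = c ! Suc i then [take i c @ drop (i + 2) c] else [])"
| "successors (i, Cross x) c = [take i c @ [c ! Suc i, c ! i] @ drop (i + 2) c]"

primrec colourings :: "tangle \<Rightarrow> bool list \<Rightarrow> nat" where
  "colourings [] c = 1"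
| "colourings (l # T) c = (\<Sum>d\<leftarrow>successors l c. colourings T d)"

text \<open>
  This extends \<open>width\<close>, the case \<open>m = 0\<close>, to tangles that start with \<open>m\<close> strands.
\<close>

definition strands :: "nat \<Rightarrow> tangle \<Rightarrow> nat" where
  "strands m T = foldl (\<lambda>w (i, p). w - legs_below p + legs_above p) m T"

lemma strands_simps [simp]:
  "strands m [] = m"
  "strands m ((i, p) # T) = strands (m - legs_below p + legs_above p) T"
  by (simp_all add: strands_def)

lemma is_tangle_strands: "is_tangle m T n \<Longrightarrow> strands m T = n"
  by (induction m T n rule: is_tangle.induct) auto

lemma is_tangle_append:
  "is_tangle m (T @ T') n \<longleftrightarrow> is_tangle m T (strands m T) \<and> is_tangle (strands m T) T' n"
  by (induction m T n rule: is_tangle.induct) auto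

lemma length_successors:
  assumes "d \<in> set (successors (i, p) c)" "i + legs_below p \<le> length c"
  shows "length d = length c - legs_below p + legs_above p"
  using assms by (cases p) (auto split: if_splits)

lemma distinct_successors: "distinct (successors l c)"
  by (cases "(l, c)" rule: successors.cases) auto

text \<open>
  The successors are determined by the conditions that the two ends of each arc of the layer have
  the same colour. This links the recursive count to the relation \<open>joined\<close>.
\<close>

lemma successors_iff:
  assumes "i + legs_below p \<le> length c"
  shows "d \<in> set (successors (i, p) c) \<longleftrightarrow>
    length d = length c - legs_below p + legs_above p \<and> (\<forall>j<i. c ! j = d ! j) \<and>
    (\<forall>j. i + legs_below p + j < length c \<longrightarrow> c ! (i + legs_below p + j) = d ! (i + legs_above p + j)) \<and>
    (case p of Cup \<Rightarrow> d ! i = d ! Suc i | Cap \<Rightarrow> c ! i = c ! Suc i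
      | Cross x \<Rightarrow> c ! i = d ! Suc i \<and> c ! Suc i = d ! i)" (is "_ = ?R")
proof
  assume "d \<in> set (successors (i, p) c)"
  with assms show ?R
    by (cases p) (auto simp: nth_append nth_Cons min_def split: if_splits nat.splits)
next
  assume R: ?R
  have 1: "take i d = take i c"
    using R assms by (intro nth_equalityI) auto
  have 2: "drop (i + legs_above p) d = drop (i + legs_below p) c"
    using R assms by (intro nth_equalityI) (auto simp: algebra_simps)
  have d: "d = take i c @ take (legs_above p) (drop i d) @ drop (i + legs_below p) c"
    unfolding 1[symmetric] 2[symmetric] by (metis append_take_drop_id drop_drop add.commute)
  have 3: "take 2 (drop i d) = [d ! i, d ! Suc i]" if "Suc i < length d"
    using that by (simp add: numeral_2_eq_2 take_Suc_conv_app_nth)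
  show "d \<in> set (successors (i, p) c)"
  proof (cases p)
    case Cup
    with d R 3 assms show ?thesis by (cases "d ! i") auto
  next
    case Cap
    with d R show ?thesis by simp
  next
    case (Cross x)
    with d R 3 assms show ?thesis by simp
  qed
qed

definition tangle_points :: "nat \<Rightarrow> tangle \<Rightarrow> (nat \<times> nat) set" where
  "tangle_points m T = {(t, j). t \<le> length T \<and> j < strands m (take t T)}"

lemma tangle_points_Cons:
  "(0, j) \<in> tangle_points m T \<longleftrightarrow> j < m"
  "(Suc t, j) \<in> tangle_points m ((i, p) # T) \<longleftrightarrow>
     (t, j) \<in> tangle_points (m - legs_below p + legs_above p) T"
  by (simp_all add: tangle_points_def)

lemma finite_tangle_points: "finite (tangle_points m T)"
proof -
  have "tangle_points m T = (SIGMA t:{..length T}. {..<strands m (take t T)})"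
    by (auto simp: tangle_points_def)
  then show ?thesis by simp
qed

text \<open>
  The contribution of a single layer to \<open>joined\<close>, with the heights below and above it called 0
  and 1; it makes an induction over the layers from the bottom possible.
\<close>

inductive joined_by :: "nat \<times> piece \<Rightarrow> nat \<times> nat \<Rightarrow> nat \<times> nat \<Rightarrow> bool" where
  "j < i \<Longrightarrow> joined_by (i, p) (0, j) (Suc 0, j)"
| "joined_by (i, p) (0, i + legs_below p + j) (Suc 0, i + legs_above p + j)"
| "joined_by (i, Cup) (Suc 0, i) (Suc 0, Suc i)"
| "joined_by (i, Cap) (0, i) (0, Suc i)"
| "joined_by (i, Cross c) (0, i) (Suc 0, Suc i)"
| "joined_by (i, Cross c) (0, Suc i) (Suc 0, i)"

lemma joined_Cons:
  "joined (l # T) x y \<longleftrightarrow> joined_by l x y \<or>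
     (\<exists>t j t' j'. x = (Suc t, j) \<and> y = (Suc t', j') \<and> joined T (t, j) (t', j'))" (is "?L = ?R")
proof
  assume ?L then show ?R
  proof cases
    case (left_of_piece t i p j)
    then show ?thesis by (cases t) (auto intro: joined_by.intros joined.intros)
  next
    case (right_of_piece t i p j)
    then show ?thesis by (cases t) (auto intro: joined_by.intros joined.intros)
  next
    case (cup t i)
    then show ?thesis by (cases t) (auto intro: joined_by.intros joined.intros)
  next
    case (cap t i)
    then show ?thesis by (cases t) (auto intro: joined_by.intros joined.intros)
  next
    case (cross_rising t i c)
    then show ?thesis by (cases t) (auto intro: joined_by.intros joined.intros)
  next
    case (cross_falling t i c)
    then show ?thesis by (cases t) (auto intro: joined_by.intros joined.intros)
  qed
next
  assume ?R then show ?L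
  proof (elim disjE exE conjE)
    assume "joined_by l x y"
    then show ?thesis
      by cases (use joined.intros[of 0 "l # T"] in auto)
  next
    fix t j t' j' assume [simp]: "x = (Suc t, j)" "y = (Suc t', j')" and "joined T (t, j) (t', j')"
    from this(3) show ?thesis
      by cases (auto intro: joined.intros[of "Suc _" "l # T", simplified])
  qed
qed

lemma not_joined_Nil [simp]: "\<not> joined [] x y"
  by (auto elim: joined.cases)

lemma joined_by_points:
  assumes "joined_by (i, p) (t, j) (t', j')" "i + legs_below p \<le> m" 
  shows "(t, j) \<in> tangle_points m ((i, p) # T) \<longleftrightarrow> (t', j') \<in> tangle_points m ((i, p) # T)"
  using assms by cases (auto simp: tangle_points_Cons)

text \<open>
  The rule for the strands to the right of a piece also joins points beyond the last strand. These
  pairs do not mix with the points of the diagram.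
\<close>

lemma joined_points:
  "joined T x y \<Longrightarrow> is_tangle m T n \<Longrightarrow> x \<in> tangle_points m T \<longleftrightarrow> y \<in> tangle_points m T"
proof (induction m T n arbitrary: x y rule: is_tangle.induct)
  case (2 m i p T n)
  then show ?case
    by (cases x; cases y) (auto simp: joined_Cons tangle_points_Cons dest: joined_by_points)
qed auto

text \<open>
  A 2-colouring is represented by the set of the points with the colour \<open>True\<close>. The list \<open>c\<close>
  prescribes the colours at the bottom.
\<close>

definition compatible_sets :: "tangle \<Rightarrow> bool list \<Rightarrow> (nat \<times> nat) set set" where
  "compatible_sets T c = {S. S \<subseteq> tangle_points (length c) T \<and>
     (\<forall>x y. joined T x y \<longrightarrow> x \<in> tangle_points (length c) T \<longrightarrow> (x \<in> S \<longleftrightarrow> y \<in> S)) \<and>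
     (\<forall>j<length c. (0, j) \<in> S \<longleftrightarrow> c ! j)}"

definition on_top_of :: "bool list \<Rightarrow> (nat \<times> nat) set \<Rightarrow> (nat \<times> nat) set" where
  "on_top_of c S = {(t, j). case t of 0 \<Rightarrow> j < length c \<and> c ! j | Suc t \<Rightarrow> (t, j) \<in> S}"

lemma on_top_of_simps [simp]:
  "(0, j) \<in> on_top_of c S \<longleftrightarrow> j < length c \<and> c ! j"
  "(Suc t, j) \<in> on_top_of c S \<longleftrightarrow> (t, j) \<in> S"
  by (auto simp: on_top_of_def)

lemma subset_points_Cons:
  "S \<subseteq> tangle_points m ((i, p) # T) \<longleftrightarrow> (\<forall>j. (0, j) \<in> S \<longrightarrow> j < m) \<and>
     {(t, j). (Suc t, j) \<in> S} \<subseteq> tangle_points (m - legs_below p + legs_above p) T"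
  (is "?L = ?R")
proof
  assume L: ?L
  show ?R
    using subsetD[OF L, of "(0, _)"] subsetD[OF L, of "(Suc _, _)"] by (auto simp: tangle_points_Cons)
next
  assume R: ?R
  show ?L
  proof
    fix x assume x: "x \<in> S"
    obtain t j where tj: "x = (t, j)" by (cases x)
    show "x \<in> tangle_points m ((i, p) # T)"
    proof (cases t)
      case 0
      then show ?thesis using R x by (simp add: tj tangle_points_Cons)
    next
      case (Suc s)
      then have "(s, j) \<in> {(t, j). (Suc t, j) \<in> S}" using x tj by simp
      then show ?thesis using R unfolding tj Suc tangle_points_Cons by blast
    qed
  qed
qed

lemma compatible_sets_Cons:
  assumes "i + legs_below p \<le> length c"
  shows "compatible_sets ((i, p) # T) c =
    (\<Union>d\<in>set (successors (i, p) c). on_top_of c ` compatible_sets T d)" (is "?L = ?R")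
proof
  let ?m = "length c - legs_below p + legs_above p"
  show "?L \<subseteq> ?R"
  proof
    fix S assume S: "S \<in> ?L"
    define d where "d = map (\<lambda>j. (Suc 0, j) \<in> S) [0..<?m]"
    define S' where "S' = {(t, j). (Suc t, j) \<in> S}"
    have jb: "x \<in> S \<longleftrightarrow> y \<in> S" if "joined_by (i, p) x y" "x \<in> tangle_points (length c) ((i, p) # T)" for x y
      using S that unfolding compatible_sets_def joined_Cons by blast
    have c: "(0, j) \<in> S \<longleftrightarrow> c ! j" if "j < length c" for j
      using S that by (auto simp: compatible_sets_def)
    have d: "d ! j \<longleftrightarrow> (Suc 0, j) \<in> S" if "j < ?m" for j
      using that by (simp add: d_def)
    have "d \<in> set (successors (i, p) c)"
      unfolding successors_iff[OF assms]
    proof (intro conjI allI impI)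
      show "length d = ?m" by (simp add: d_def)
    next
      fix j assume "j < i"
      then show "c ! j = d ! j"
        using jb[OF joined_by.intros(1)[of j i p]] assms d[of j] c[of j] by (simp add: tangle_points_Cons)
    next
      fix j assume "i + legs_below p + j < length c"
      then show "c ! (i + legs_below p + j) = d ! (i + legs_above p + j)"
        using jb[OF joined_by.intros(2)[of i p j]] assms d[of "i + legs_above p + j"]
          c[of "i + legs_below p + j"] by (simp add: tangle_points_Cons)
    next
      show "case p of Cup \<Rightarrow> d ! i = d ! Suc i | Cap \<Rightarrow> c ! i = c ! Suc i
          | Cross x \<Rightarrow> c ! i = d ! Suc i \<and> c ! Suc i = d ! i"
      proof (cases p)
        case Cup
        then show ?thesis using jb[of "(Suc 0, i)" "(Suc 0, Suc i)"] assms d[of i] d[of "Suc i"]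
          by (simp add: tangle_points_Cons joined_by.intros)
      next
        case Cap
        then show ?thesis using jb[of "(0, i)" "(0, Suc i)"] assms c[of i] c[of "Suc i"]
          by (simp add: tangle_points_Cons joined_by.intros)
      next
        case (Cross x)
        then show ?thesis using jb[of "(0, i)" "(Suc 0, Suc i)"] jb[of "(0, Suc i)" "(Suc 0, i)"]
            assms c[of i] c[of "Suc i"] d[of i] d[of "Suc i"]
          by (simp add: tangle_points_Cons joined_by.intros)
      qed
    qed
    moreover have "S' \<in> compatible_sets T d"
      using S by (auto simp: compatible_sets_def S'_def d_def subset_points_Cons tangle_points_Cons joined_Cons)
    moreover have "S = on_top_of c S'"
    proof (rule set_eqI)
      fix x show "x \<in> S \<longleftrightarrow> x \<in> on_top_of c S'"
        using S by (cases x; cases "fst x") (auto simp: compatible_sets_def S'_def subset_points_Cons)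
    qed
    ultimately show "S \<in> ?R" by blast
  qed
  show "?R \<subseteq> ?L"
  proof
    fix S assume "S \<in> ?R"
    then obtain d S' where ds: "d \<in> set (successors (i, p) c)" and S': "S' \<in> compatible_sets T d"
      and S: "S = on_top_of c S'" by blast
    note d = ds[unfolded successors_iff[OF assms]]
    have S0: "(0, j) \<in> S' \<longleftrightarrow> d ! j" if "j < ?m" for j
      using S' d that by (auto simp: compatible_sets_def)
    have "x \<in> S \<longleftrightarrow> y \<in> S" if "joined_by (i, p) x y" "x \<in> tangle_points (length c) ((i, p) # T)" for x y
      using that
      by cases (use assms d in \<open>auto simp: S S0 tangle_points_Cons\<close>)
    then show "S \<in> ?L"
      using S' d unfolding S by (auto simp: compatible_sets_def joined_Cons subset_points_Cons tangle_points_Cons)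
  qed
qed

text \<open>
  A colouring of \<open>l # T\<close> is the same as a choice of the colours above \<open>l\<close> together with a colouring
  of \<open>T\<close> that starts with them, and different choices give different colourings.
\<close>

lemma card_compatible_sets:
  "is_tangle (length c) T n \<Longrightarrow> finite (compatible_sets T c) \<and> card (compatible_sets T c) = colourings T c"
proof (induction T arbitrary: c)
  case Nil
  have "compatible_sets [] c = {{(t, j). t = 0 \<and> j < length c \<and> c ! j}}"
    by (auto simp: compatible_sets_def tangle_points_def)
  then show ?case by simp
next
  case (Cons l T)
  obtain i p where l: "l = (i, p)" by (cases l)
  have i: "i + legs_below p \<le> length c"
    and T: "is_tangle (length c - legs_below p + legs_above p) T n"
    using Cons.prems by (auto simp: l)
  have IH: "finite (compatible_sets T d) \<and> card (compatible_sets T d) = colourings T d"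
    if "d \<in> set (successors l c)" for d
    using Cons.IH[of d] T length_successors[of d i p c] that i by (simp add: l)
  have inj: "inj (on_top_of c)"
    by (rule injI) (auto simp: set_eq_iff on_top_of_def split: nat.splits)
  have "card (compatible_sets (l # T) c) =
      (\<Sum>d\<in>set (successors l c). card (on_top_of c ` compatible_sets T d))"
    unfolding l compatible_sets_Cons[OF i]
  proof (rule card_UN_disjoint, simp_all add: IH[unfolded l], intro ballI impI)
    fix d e assume de: "d \<in> set (successors (i, p) c)" "e \<in> set (successors (i, p) c)" "d \<noteq> e"
    have "length d = length e"
      using de i by (simp add: length_successors)
    then obtain j where "j < length d" "d ! j \<noteq> e ! j"
      using de(3) nth_equalityI by blast
    with \<open>length d = length e\<close> have "compatible_sets T d \<inter> compatible_sets T e = {}"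
      by (auto simp: compatible_sets_def)
    then show "on_top_of c ` compatible_sets T d \<inter> on_top_of c ` compatible_sets T e = {}"
      by (metis image_Int[OF inj] image_empty)
  qed
  also have "\<dots> = (\<Sum>d\<in>set (successors l c). colourings T d)"
    using IH inj by (intro sum.cong) (auto simp: card_image inj_on_subset)
  also have "\<dots> = colourings (l # T) c"
    by (simp add: sum_list_distinct_conv_sum_set distinct_successors)
  finally show ?case
    using IH by (simp add: l compatible_sets_Cons[OF i])
qed

text \<open>
  The saturated sets are the unions of equivalence classes.
\<close>

lemma card_saturated_sets:
  assumes "equiv P E" "finite P"
  shows "card {S. S \<subseteq> P \<and> (\<forall>(x, y)\<in>E. x \<in> S \<longleftrightarrow> y \<in> S)} = 2 ^ card (P // E)"
proof -
  let ?S = "{S. S \<subseteq> P \<and> (\<forall>(x, y)\<in>E. x \<in> S \<longleftrightarrow> y \<in> S)}"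
  have 1: "\<Union>Q \<in> ?S" if Q: "Q \<subseteq> P // E" for Q
  proof -
    have "\<Union>Q \<subseteq> P"
      using Q assms(1) in_quotient_imp_subset by blast
    moreover have "y \<in> \<Union>Q" if "(x, y) \<in> E" "x \<in> \<Union>Q" for x y
      using Q in_quotient_imp_closed[OF assms(1) _ _ that(1)] that(2) by blast
    moreover have "(y, x) \<in> E" if "(x, y) \<in> E" for x y
      using assms(1) that by (meson equivE symE)
    ultimately show ?thesis by blast
  qed
  have 2: "{X \<in> P // E. X \<subseteq> \<Union>Q} = Q" if Q: "Q \<subseteq> P // E" for Q
  proof -
    have "X \<in> Q" if "X \<in> P // E" "X \<subseteq> \<Union>Q" for X
    proof -
      have "X \<noteq> {}" using in_quotient_imp_non_empty[OF assms(1) that(1)] .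
      then obtain x where "x \<in> X" by blast
      with that obtain Z where "x \<in> Z" "Z \<in> Q" by blast
      with quotient_disj[OF assms(1) that(1), of Z] Q \<open>x \<in> X\<close> show ?thesis by blast
    qed
    then show ?thesis using Q by blast
  qed
  have 3: "\<Union>{X \<in> P // E. X \<subseteq> S} = S" if S: "S \<in> ?S" for S
  proof -
    have "E `` {x} \<in> P // E \<and> x \<in> E `` {x} \<and> E `` {x} \<subseteq> S" if "x \<in> S" for x
    proof -
      have "x \<in> P" using S that by blast
      then show ?thesis
        using S that equiv_class_self[OF assms(1)] quotientI[of x P E] by blast
    qed
    then show ?thesis by blast
  qed
  have "bij_betw \<Union> (Pow (P // E)) ?S"
  proof (rule bij_betw_byWitness[where f' = "\<lambda>S. {X \<in> P // E. X \<subseteq> S}"])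
    show "\<forall>Q\<in>Pow (P // E). {X \<in> P // E. X \<subseteq> \<Union>Q} = Q" using 2 by simp
    show "\<forall>S\<in>?S. \<Union>{X \<in> P // E. X \<subseteq> S} = S" using 3 by (rule ballI)
    show "\<Union> ` Pow (P // E) \<subseteq> ?S" by (rule image_subsetI, rule 1) simp
    show "(\<lambda>S. {X \<in> P // E. X \<subseteq> S}) ` ?S \<subseteq> Pow (P // E)" by (rule image_subsetI) simp
  qed
  then have "card ?S = card (Pow (P // E))"
    by (rule bij_betw_same_card[symmetric])
  moreover have "finite (P // E)"
    using assms finite_quotient equiv_type by blast
  ultimately show ?thesis
    by (simp add: card_Pow)
qed

lemma colourings_num_components:
  assumes "link_word D"
  shows "colourings D [] = 2 ^ num_components D"
proof -
  let ?P = "points D"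
  let ?E = "{(x, y). x \<in> ?P \<and> y \<in> ?P \<and> equivclp (joined D) x y}"
  have P: "?P = tangle_points 0 D"
    by (simp add: points_def tangle_points_def width_def strands_def)
  have closed: "x \<in> ?P \<longleftrightarrow> y \<in> ?P" if "joined D x y" for x y
    using joined_points[OF that] assms by (simp add: P link_word_def)
  have "equiv ?P ?E"
  proof (rule equivI)
    show "?E \<subseteq> ?P \<times> ?P" by blast
    show "refl_on ?P ?E" by (auto intro: refl_onI)
    show "sym ?E" by (rule symI) (blast intro: equivclp_sym)
    show "trans ?E" by (rule transI) (blast intro: equivclp_trans)
  qed
  moreover have "compatible_sets D [] = {S. S \<subseteq> ?P \<and> (\<forall>(x, y)\<in>?E. x \<in> S \<longleftrightarrow> y \<in> S)}"
  proof (rule set_eqI)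
    fix S
    have "S \<subseteq> ?P \<and> (\<forall>x y. joined D x y \<longrightarrow> x \<in> ?P \<longrightarrow> (x \<in> S \<longleftrightarrow> y \<in> S)) \<longleftrightarrow>
        S \<subseteq> ?P \<and> (\<forall>(x, y)\<in>?E. x \<in> S \<longleftrightarrow> y \<in> S)" (is "?L = ?R")
    proof
      assume L: ?L
      have "x \<in> ?P \<longleftrightarrow> y \<in> ?P" "x \<in> S \<longleftrightarrow> y \<in> S" if "equivclp (joined D) x y" for x y
        using that
      proof (induction rule: equivclp_induct)
        case (step y z)
        then show "x \<in> ?P \<longleftrightarrow> z \<in> ?P" "x \<in> S \<longleftrightarrow> z \<in> S" using closed L by blast+
      qed auto
      then show ?R using L by blast
    next
      assume ?R then show ?L using closed by fast
    qed
    then show "S \<in> compatible_sets D [] \<longleftrightarrow> S \<in> {S. S \<subseteq> ?P \<and> (\<forall>(x, y)\<in>?E. x \<in> S \<longleftrightarrow> y \<in> S)}"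
      by (simp add: compatible_sets_def P)
  qed
  ultimately show ?thesis
    using card_saturated_sets[of ?P ?E] card_compatible_sets[of "[]" D 0] assms
    by (simp add: num_components_def link_word_def finite_tangle_points P)
qed

section \<open>Interchangeable tangles\<close>

text \<open>
  Equality of the counts in every context: \<open>l\<close> and \<open>r\<close> are the colours of the strands on the left
  and on the right of the disk, and \<open>v\<close> is what follows above it. What lies below the disk can be
  ignored, because it is read first and only decides which \<open>l\<close>, \<open>c\<close>, \<open>r\<close> have to be considered.
\<close>

definition same_colourings :: "nat \<Rightarrow> tangle \<Rightarrow> tangle \<Rightarrow> bool" where
  "same_colourings a T T' \<longleftrightarrow> (\<forall>l c r v. length c = a \<longrightarrow>
     colourings (shift (length l) T @ v) (l @ c @ r) = colourings (shift (length l) T' @ v) (l @ c @ r))"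

lemma shift_simps [simp]:
  "shift k [] = []"
  "shift k ((i, p) # T) = (k + i, p) # shift k T"
  "shift k (T @ T') = shift k T @ shift k T'"
  by (simp_all add: shift_def)

lemma shift_0 [simp]: "shift 0 T = T"
  by (induction T) (auto simp: shift_def)

lemma shift_shift [simp]: "shift k (shift l T) = shift (k + l) T"
  by (auto simp: shift_def)

lemma is_tangle_shift: "is_tangle m T n \<Longrightarrow> is_tangle (k + m + r) (shift k T) (k + n + r)"
proof (induction m T n rule: is_tangle.induct)
  case (2 m i p T n)
  then obtain w where "m = i + legs_below p + w" by (auto simp: le_iff_add)
  with 2 show ?case by (simp add: add_ac)
qed simp

lemma is_tangle_appendI: "is_tangle a T b \<Longrightarrow> is_tangle b T' c \<Longrightarrow> is_tangle a (T @ T') c"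
  using is_tangle_append is_tangle_strands by auto

lemma colourings_append_cong:
  assumes "is_tangle a u b" "length c = a"
    and "\<And>d. length d = b \<Longrightarrow> colourings T d = colourings T' d"
  shows "colourings (u @ T) c = colourings (u @ T') c"
  using assms
proof (induction u arbitrary: a c)
  case (Cons l u)
  obtain i p where l: "l = (i, p)" by (cases l)
  have "colourings (u @ T) d = colourings (u @ T') d" if "d \<in> set (successors l c)" for d
  proof (rule Cons.IH)
    show "is_tangle (length d) u b"
      using length_successors[of d i p c] that Cons.prems(1,2) by (auto simp: l)
  qed (use Cons.prems in auto)
  then have "map (colourings (u @ T)) (successors l c) = map (colourings (u @ T')) (successors l c)"
    by simp
  then show ?case by (simp del: map_eq_conv)
qed simp

lemma same_colourings_context:
  assumes "same_colourings a T T'" "is_tangle m x (k + a + r)"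
  shows "same_colourings m (x @ shift k T @ y) (x @ shift k T' @ y)"
  unfolding same_colourings_def
proof (intro allI impI)
  fix l c s v assume c: "length (c :: bool list) = m"
  show "colourings (shift (length l) (x @ shift k T @ y) @ v) (l @ c @ s) =
    colourings (shift (length l) (x @ shift k T' @ y) @ v) (l @ c @ s)"
    unfolding shift_simps append_assoc
  proof (rule colourings_append_cong)
    show "is_tangle (length l + m + length s) (shift (length l) x) (length l + (k + a + r) + length s)"
      using assms(2) by (rule is_tangle_shift)
    show "length (l @ c @ s) = length l + m + length s" using c by simp
    fix d :: "bool list" assume d: "length d = length l + (k + a + r) + length s"
    have "d = take (length l + k) d @ take a (drop (length l + k) d) @ drop (length l + k + a) d"
      by (metis append_take_drop_id drop_drop add.commute)
    moreover have "length (take (length l + k) d) = length l + k"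
      "length (take a (drop (length l + k) d)) = a" using d by simp_all
    ultimately show "colourings (shift (length l) (shift k T) @ shift (length l) y @ v) d =
      colourings (shift (length l) (shift k T') @ shift (length l) y @ v) d"
      using assms(1) unfolding same_colourings_def shift_shift by metis
  qed
qed

lemma same_colourings_at:
  assumes "same_colourings a T T'" "is_tangle m (x @ z) b" "k + a \<le> strands m x"
  shows "same_colourings m (x @ shift k T @ y) (x @ shift k T' @ y)"
proof -
  obtain r where "strands m x = k + a + r" using assms(3) le_Suc_ex by blast
  then show ?thesis
    using same_colourings_context[OF assms(1)] assms(2) is_tangle_append by metis
qed

lemma same_colourings_sym: "same_colourings a T T' \<Longrightarrow> same_colourings a T' T"
  by (simp add: same_colourings_def)

lemma same_colourings_trans:
  "same_colourings a T T' \<Longrightarrow> same_colourings a T' T'' \<Longrightarrow> same_colourings a T T''"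
  by (simp add: same_colourings_def)

text \<open>
  The calculations are made with words, so planar isotopy is a step of its own. It becomes an
  equality of diagrams.
\<close>

definition elementary_move :: "nat \<Rightarrow> tangle \<Rightarrow> tangle \<Rightarrow> bool" where
  "elementary_move n D D' \<longleftrightarrow> local_step isotopy_rule D D' \<or> local_step generalized_rule D D' \<or>
     (local_step (H_rule n) D D' \<and> num_components D = num_components D')"

lemma elementary_moves_abs:
  assumes "(elementary_move n)\<^sup>*\<^sup>* D D'"
  shows "(\<lambda>W W'. H_move n W W' \<or> welded_move W W')\<^sup>*\<^sup>* (abs_link_diagram D) (abs_link_diagram D')"
  using assms
proof (induction rule: rtranclp_induct)
  case (step D' D'')
  have "abs_link_diagram D' = abs_link_diagram D''" if "local_step isotopy_rule D' D''"
  proof -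
    have "isotopic D' D''"
      using that unfolding isotopic_def local_step_def by blast
    then show ?thesis
      using Quotient3_rel_abs[OF Quotient3_link_diagram] by blast
  qed
  then have "abs_link_diagram D' = abs_link_diagram D'' \<or> H_move n (abs_link_diagram D') (abs_link_diagram D'')
      \<or> welded_move (abs_link_diagram D') (abs_link_diagram D'')"
    using step.hyps(2) unfolding elementary_move_def H_move_def welded_move_def diagram_move_def by blast
  with step.IH show ?case
    by (auto intro: rtranclp.rtrancl_into_rtrancl)
qed simp

text \<open>
  Two tangles from \<open>a\<close> to \<open>b\<close> strands are interchangeable if one can be transformed into the other
  inside any closed diagram. The numbers of strands are part of the notion because the empty word,
  which occurs as one side of several rules, is a tangle on any number of strands.
\<close>

definition interchangeable :: "nat \<Rightarrow> nat \<Rightarrow> nat \<Rightarrow> tangle \<Rightarrow> tangle \<Rightarrow> bool" where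
  "interchangeable n a b T T' \<longleftrightarrow> is_tangle a T b \<and> is_tangle a T' b \<and>
     (\<forall>u v k r. is_tangle 0 u (k + a + r) \<longrightarrow> is_tangle (k + b + r) v 0 \<longrightarrow>
       (elementary_move n)\<^sup>*\<^sup>* (u @ shift k T @ v) (u @ shift k T' @ v))"

lemma interchangeable_refl: "is_tangle a T b \<Longrightarrow> interchangeable n a b T T"
  by (simp add: interchangeable_def)

lemma interchangeable_sym: "interchangeable n a b T T' \<Longrightarrow> interchangeable n a b T' T"
proof -
  have "symp (elementary_move n)"
    by (rule sympI) (auto simp: elementary_move_def intro: local_step_sym)
  then show "interchangeable n a b T T' \<Longrightarrow> interchangeable n a b T' T"
    unfolding interchangeable_def by (meson sympD symp_rtranclp)
qed

lemma interchangeable_trans [trans]: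
  "interchangeable n a b T T' \<Longrightarrow> interchangeable n a b T' T'' \<Longrightarrow> interchangeable n a b T T''"
  unfolding interchangeable_def by (meson rtranclp_trans)

lemma interchangeable_context:
  assumes "interchangeable n a b T T'" "is_tangle A x (k + a + r)" "is_tangle (k + b + r) y B"
  shows "interchangeable n A B (x @ shift k T @ y) (x @ shift k T' @ y)"
  unfolding interchangeable_def
proof (intro conjI allI impI)
  show "is_tangle A (x @ shift k T @ y) B" "is_tangle A (x @ shift k T' @ y) B"
    using assms unfolding interchangeable_def by (meson is_tangle_appendI is_tangle_shift)+
  fix u v l s assume u: "is_tangle 0 u (l + A + s)" and v: "is_tangle (l + B + s) v 0"
  have "is_tangle 0 (u @ shift l x) (l + k + a + (r + s))"
    using is_tangle_appendI[OF u is_tangle_shift[OF assms(2), of l s]] by (simp add: add_ac)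
  moreover have "is_tangle (l + k + b + (r + s)) (shift l y @ v) 0"
    using is_tangle_appendI[OF is_tangle_shift[OF assms(3), of l s] v] by (simp add: add_ac)
  ultimately show "(elementary_move n)\<^sup>*\<^sup>* (u @ shift l (x @ shift k T @ y) @ v)
      (u @ shift l (x @ shift k T' @ y) @ v)"
    using assms(1) unfolding interchangeable_def shift_simps shift_shift by (metis append_assoc)
qed

lemma interchangeable_at:
  assumes "interchangeable n a b L R" "is_tangle A (x @ shift k L @ y) B" "k + a \<le> strands A x"
  shows "interchangeable n A B (x @ shift k L @ y) (x @ shift k R @ y)"
proof -
  obtain r where r: "strands A x = k + a + r" using assms(3) le_Suc_ex by blast
  have x: "is_tangle A x (k + a + r)" and y: "is_tangle (k + a + r) (shift k L @ y) B"
    using assms(2) unfolding is_tangle_append[of A] r by blast+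
  have "is_tangle (k + a + r) (shift k L) (k + b + r)"
    using assms(1) is_tangle_shift unfolding interchangeable_def by blast
  with y have "is_tangle (k + b + r) y B"
    unfolding is_tangle_append[of _ _ y] by (metis is_tangle_strands)
  from interchangeable_context[OF assms(1) x this] show ?thesis .
qed

text \<open>
  The form in which tangles are transformed below: the occurrence of \<open>L\<close> in \<open>T\<close> that begins after
  \<open>q\<close> layers, with \<open>k\<close> strands to its left, is replaced by \<open>R\<close>.
\<close>

lemma rewrite_at:
  assumes "interchangeable n a b L R"
    and "take (length L) (drop q T) = shift k L"
    and "T' = take q T @ shift k R @ drop (q + length L) T"
    and "is_tangle A T B" "k + a \<le> strands A (take q T)"
  shows "interchangeable n A B T T'"
proof -
  have "T = take q T @ shift k L @ drop (q + length L) T"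
    by (metis append_take_drop_id assms(2) drop_drop add.commute)
  then show ?thesis
    using interchangeable_at[OF assms(1) _ assms(5)] assms(3,4) by metis
qed

lemma interchangeable_rule:
  assumes "R T T' \<or> R T' T" "is_tangle a T b" "is_tangle a T' b"
    and "R = isotopy_rule \<or> R = generalized_rule"
  shows "interchangeable n a b T T'"
  unfolding interchangeable_def
proof (intro conjI allI impI)
  fix u v k r assume "is_tangle 0 u (k + a + r)" "is_tangle (k + b + r) v 0"
  then have "link_word (u @ shift k T @ v)" "link_word (u @ shift k T' @ v)"
    using assms(2,3) unfolding link_word_def by (meson is_tangle_appendI is_tangle_shift)+
  then have "local_step R (u @ shift k T @ v) (u @ shift k T' @ v)"
    unfolding local_step_def using assms(1) by blast
  then show "(elementary_move n)\<^sup>*\<^sup>* (u @ shift k T @ v) (u @ shift k T' @ v)"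
    using assms(4) unfolding elementary_move_def by blast
qed (use assms in auto)

abbreviation vi :: "nat \<Rightarrow> nat \<times> piece" where "vi i \<equiv> (i, Cross Virtual)"
abbreviation un :: "nat \<Rightarrow> nat \<times> piece" where "un i \<equiv> (i, Cross Under)"
abbreviation ov :: "nat \<Rightarrow> nat \<times> piece" where "ov i \<equiv> (i, Cross Over)"
abbreviation cup :: "nat \<Rightarrow> nat \<times> piece" where "cup i \<equiv> (i, Cup)"
abbreviation cap :: "nat \<Rightarrow> nat \<times> piece" where "cap i \<equiv> (i, Cap)"

lemma exchange:
  assumes "a = legs_below p + d + legs_below q" "b = legs_above p + d + legs_above q"
  shows "interchangeable n a b [(0, p), (legs_above p + d, q)] [(legs_below p + d, q), (0, p)]"
  by (rule interchangeable_rule[where R = isotopy_rule]) (auto simp: assms intro: isotopy_rule.intros)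

lemma zigzag_left: "interchangeable n 1 1 [cup 1, cap 0] []"
  and zigzag_right: "interchangeable n 1 1 [cup 0, cap 1] []"
  and cap_slide: "interchangeable n 3 1 [(1, Cross c), cap 0] [(0, Cross (opposite c)), cap 1]"
  and cup_slide: "interchangeable n 1 3 [cup 0, (1, Cross c)] [cup 1, (0, Cross (opposite c))]"
  by (rule interchangeable_rule[where R = isotopy_rule]; simp add: isotopy_rule.intros del: One_nat_def)+

lemma VR1_cup: "interchangeable n 0 2 [cup 0, vi 0] [cup 0]"
  and VR2: "interchangeable n 2 2 [vi 0, vi 0] []"
  and VR3: "interchangeable n 3 3 [vi 0, vi 1, vi 0] [vi 1, vi 0, vi 1]"
  and VR4_1: "c \<noteq> Virtual \<Longrightarrow> interchangeable n 3 3 [vi 0, vi 1, (0, Cross c)] [(1, Cross c), vi 0, vi 1]"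
  and VR4_2: "c \<noteq> Virtual \<Longrightarrow> interchangeable n 3 3 [vi 0, (1, Cross c), vi 0] [vi 1, (0, Cross c), vi 1]"
  and VR4_3: "c \<noteq> Virtual \<Longrightarrow> interchangeable n 3 3 [(0, Cross c), vi 1, vi 0] [vi 1, vi 0, (1, Cross c)]"
  using generalized_rule.intros[unfolded triangle_def triangle'_def]
  by (intro interchangeable_rule[where R = generalized_rule]; simp)+

text \<open>
  The rule for a virtual kink is stated at a minimum. To use it at a maximum, a zigzag in the
  strand on the right provides a minimum, through which the crossing is slid.
\<close>

lemma VR1_cap: "interchangeable n 2 0 [vi 0, cap 0] [cap 0]"
proof -
  have "interchangeable n 2 0 [vi 0, cap 0] [vi 0, cup 2, cap 1, cap 0]"
    by (rule rewrite_at[OF zigzag_left[THEN interchangeable_sym], of 1 _ 1]; simp)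
  also have "interchangeable n 2 0 \<dots> [cup 2, vi 0, cap 1, cap 0]"
    by (rule rewrite_at[OF exchange[of _ "Cross Virtual" 0 Cup, OF refl refl], of 0 _ 0]; simp)
  also have "interchangeable n 2 0 \<dots> [cup 2, vi 1, cap 0, cap 0]"
    by (rule rewrite_at[OF cap_slide[of _ Virtual, THEN interchangeable_sym], of 1 _ 0]; simp)
  also have "interchangeable n 2 0 \<dots> [cup 2, vi 1, cap 2, cap 0]"
    by (rule rewrite_at[OF exchange[of _ Cap 0 Cap, OF refl refl], of 2 _ 0]; simp)
  also have "interchangeable n 2 0 \<dots> [cup 2, vi 2, cap 1, cap 0]"
    by (rule rewrite_at[OF cap_slide[of _ Virtual, THEN interchangeable_sym], of 1 _ 1]; simp)
  also have "interchangeable n 2 0 \<dots> [cup 2, cap 1, cap 0]"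
    by (rule rewrite_at[OF VR1_cup, of 0 _ 2]; simp)
  also have "interchangeable n 2 0 \<dots> [cap 0]"
    by (rule rewrite_at[OF zigzag_left, of 0 _ 1]; simp)
  finally show ?thesis .
qed

section \<open>Reversing a segment of a strand by H(n)-moves\<close>

text \<open>
  The count of 2-colourings ensures that the number of components is preserved in every diagram
  that contains the two tangles.
\<close>

lemma H_interchangeable:
  assumes "is_tangle a T b" "is_tangle a T' b" "same_colourings a T T'"
    and "T = x @ shift k (replicate n (cap 0)) @ y"
    and "T' = x @ shift k (replicate (n - 1) (cap 1) @ [cap 0]) @ y"
  shows "interchangeable n a b T T'"
  unfolding interchangeable_def
proof (intro conjI allI impI)
  fix u v l r assume u: "is_tangle 0 u (l + a + r)" and v: "is_tangle (l + b + r) v 0"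
  let ?D = "u @ shift l T @ v" and ?D' = "u @ shift l T' @ v"
  have link: "link_word ?D" "link_word ?D'"
    using u v assms(1,2) unfolding link_word_def by (meson is_tangle_appendI is_tangle_shift)+
  have "colourings ?D [] = colourings ?D' []"
  proof -
    have "same_colourings 0 (u @ shift l T @ v) (u @ shift l T' @ v)"
      using same_colourings_context[OF assms(3) u] .
    from this[unfolded same_colourings_def, rule_format, of "[]" "[]" "[]" "[]"] show ?thesis
      by simp
  qed
  then have "num_components ?D = num_components ?D'"
    by (simp add: colourings_num_components[OF link(1)] colourings_num_components[OF link(2)])
  moreover have "local_step (H_rule n) ?D ?D'"
    unfolding local_step_def
  proof (intro conjI exI)
    show "?D = (u @ shift l x) @ shift (l + k) (replicate n (cap 0)) @ (shift l y @ v)"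
      "?D' = (u @ shift l x) @ shift (l + k) (replicate (n - 1) (cap 1) @ [cap 0]) @ (shift l y @ v)"
      by (simp_all add: assms(4,5))
  qed (use link H_rule.intros[of n] in auto)
  ultimately show "(elementary_move n)\<^sup>*\<^sup>* ?D ?D'"
    unfolding elementary_move_def by blast
qed (use assms in auto)

text \<open>
  An \<open>H(m)\<close>-move is a special case of an \<open>H(m + 1)\<close>-move: put a virtual kink on one of the \<open>m\<close> arcs
  and let this arc enter the disk twice, first before the crossing of the kink and then within its
  loop. On either side of the \<open>H(m + 1)\<close>-move the kink can be removed, by this lemma and the next
  one, and what remains are the two sides of the \<open>H(m)\<close>-move.
\<close>

lemma kink_outer: "interchangeable n 2 0 [cup 1, vi 2, cap 0, cap 0] [cap 0]"
proof -
  have "interchangeable n 2 0 [cup 1, vi 2, cap 0, cap 0] [cup 1, cap 0, vi 0, cap 0]"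
    by (rule rewrite_at[OF exchange[of _ Cap 0 "Cross Virtual", OF refl refl, THEN interchangeable_sym], of 1 _ 0]; simp)
  also have "interchangeable n 2 0 \<dots> [vi 0, cap 0]"
    by (rule rewrite_at[OF zigzag_left, of 0 _ 0]; simp)
  also have "interchangeable n 2 0 \<dots> [cap 0]"
    by (rule VR1_cap)
  finally show ?thesis .
qed

lemma kink_inner: "interchangeable n 2 2 [cup 1, vi 2, cap 1] []"
proof -
  have "interchangeable n 2 2 [cup 1, vi 2, cap 1] [cup 2, vi 1, cap 1]"
    by (rule rewrite_at[OF cup_slide[of _ Virtual], of 0 _ 1]; simp)
  also have "interchangeable n 2 2 \<dots> [cup 2, cap 1]"
    by (rule rewrite_at[OF VR1_cap, of 1 _ 1]; simp)
  also have "interchangeable n 2 2 \<dots> []"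
    by (rule rewrite_at[OF zigzag_left, of 0 _ 1]; simp)
  finally show ?thesis .
qed

text \<open>
  As a simplification rule this evaluates counts with an unknown number of strands on the left,
  since all positions are then computed within the explicit list \<open>c\<close>.
\<close>

lemma colourings_shift_Cons:
  assumes "i + legs_below p \<le> length c"
  shows "colourings (shift (length l) ((i, p) # T) @ v) (l @ c) =
    (\<Sum>d\<leftarrow>successors (i, p) c. colourings (shift (length l) T @ v) (l @ d))"
  using assms by (cases p) (auto simp: nth_append add.assoc[symmetric] intro: arg_cong2[where f = "(+)"])

lemma same_colourings_2I:
  assumes "\<And>l x y r v. colourings (shift (length l) T @ v) (l @ [x, y] @ r) =
    colourings (shift (length l) T' @ v) (l @ [x, y] @ r)"
  shows "same_colourings 2 T T'"
proof -
  have "\<exists>x y. c = [x, y]" if "length c = 2" for c :: "bool list"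
    using that by (auto simp: numeral_eq_Suc length_Suc_conv)
  then show ?thesis using assms unfolding same_colourings_def by metis
qed

lemma same_colourings_3I:
  assumes "\<And>l x y z r v. colourings (shift (length l) T @ v) (l @ [x, y, z] @ r) =
    colourings (shift (length l) T' @ v) (l @ [x, y, z] @ r)"
  shows "same_colourings 3 T T'"
proof -
  have "\<exists>x y z. c = [x, y, z]" if "length c = 3" for c :: "bool list"
    using that by (auto simp: numeral_eq_Suc length_Suc_conv)
  then show ?thesis using assms unfolding same_colourings_def by metis
qed

lemma same_colourings_kinks:
  "same_colourings 2 [cup 1, vi 2, cap 0, cap 0] [cap 0]"
  "same_colourings 2 [cup 1, vi 2, cap 1] []"
  by (rule same_colourings_2I; simp add: colourings_shift_Cons del: shift_simps(2))+

lemma same_colourings_extra_arc: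
  "same_colourings 3 [cup 3, cap 0, cap 0] [cap 0]"
  "same_colourings 3 [cup 3, cap 1, cap 0] [cap 1]"
  by (rule same_colourings_3I; simp add: colourings_shift_Cons del: shift_simps(2))+

text \<open>
  Descending induction on \<open>m\<close>, starting from \<open>m = n\<close>, by the kink of the preceding lemmas.
\<close>

lemma H_smaller_interchangeable:
  assumes "m \<le> n" "2 \<le> m" "is_tangle a T b" "is_tangle a T' b" "same_colourings a T T'"
    and "T = x @ shift k (replicate m (cap 0)) @ y"
    and "T' = x @ shift k (replicate (m - 1) (cap 1) @ [cap 0]) @ y"
  shows "interchangeable n a b T T'"
  using assms
proof (induction m arbitrary: T T' x rule: inc_induct)
  case base
  then show ?case by (intro H_interchangeable)
next
  case (step m)
  let ?rest = "shift k (replicate (m - 1) (cap 0)) @ y"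
  let ?rest' = "shift k (replicate (m - 1) (cap 1) @ [cap 0]) @ y"
  let ?S = "x @ shift k [cup 1, vi 2, cap 0, cap 0] @ ?rest"
  let ?S' = "x @ shift k [cup 1, vi 2, cap 1] @ ?rest'"
  obtain m' where m': "m = Suc m'" using \<open>2 \<le> m\<close> by (cases m) auto
  have T: "T = x @ shift k [cap 0] @ ?rest"
    using step.prems by (simp add: m')
  have T': "T' = x @ shift k [] @ ?rest'"
    using step.prems by simp
  have k: "k + 2 \<le> strands a x"
    using step.prems(2) unfolding T is_tangle_append[of a] by simp
  have TS: "interchangeable n a b T ?S"
    using interchangeable_at[OF interchangeable_sym[OF kink_outer] _ k] step.prems(2) unfolding T by blast
  have TS': "interchangeable n a b T' ?S'"
    using interchangeable_at[OF interchangeable_sym[OF kink_inner] _ k] step.prems(3) unfolding T' by blast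
  have "same_colourings a T ?S"
    using same_colourings_at[OF same_colourings_kinks(1)[THEN same_colourings_sym] _ k] step.prems(2)
    unfolding T by blast
  moreover have "same_colourings a T' ?S'"
    using same_colourings_at[OF same_colourings_kinks(2)[THEN same_colourings_sym] _ k] step.prems(3)
    unfolding T' by blast
  ultimately have "same_colourings a ?S ?S'"
    using step.prems(4) same_colourings_sym same_colourings_trans by blast
  moreover have "is_tangle a ?S b" "is_tangle a ?S' b"
    using TS TS' unfolding interchangeable_def by blast+
  ultimately have "interchangeable n a b ?S ?S'"
    using \<open>2 \<le> m\<close> by (intro step.IH[where x = "x @ shift k [cup 1, vi 2]"]) (auto simp: m')
  then show ?case
    using TS TS' interchangeable_sym interchangeable_trans by blast
qed

text \<open>
  An \<open>H(2)\<close>-move caps off four strands in two ways. If the last of them is turned upwards by an extra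
  minimum on the right, the two sides become the two ways to join three strands to one.
\<close>

lemma extra_arc_left: "interchangeable n 3 1 [cup 3, cap 0, cap 0] [cap 0]"
proof -
  have "interchangeable n 3 1 [cup 3, cap 0, cap 0] [cap 0, cup 1, cap 0]"
    by (rule rewrite_at[OF exchange[of _ Cap 1 Cup, OF refl refl, THEN interchangeable_sym], of 0 _ 0]; simp)
  also have "interchangeable n 3 1 \<dots> [cap 0]"
    by (rule rewrite_at[OF zigzag_left, of 1 _ 0]; simp)
  finally show ?thesis .
qed

lemma extra_arc_right: "interchangeable n 3 1 [cup 3, cap 1, cap 0] [cap 1]"
proof -
  have "interchangeable n 3 1 [cup 3, cap 1, cap 0] [cap 1, cup 1, cap 0]"
    by (rule rewrite_at[OF exchange[of _ Cap 0 Cup, OF refl refl, THEN interchangeable_sym], of 0 _ 1]; simp)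
  also have "interchangeable n 3 1 \<dots> [cap 1]"
    by (rule rewrite_at[OF zigzag_left, of 1 _ 0]; simp)
  finally show ?thesis .
qed

lemma smoothing:
  assumes "2 \<le> n" "is_tangle a (x @ shift k [cap 0] @ y) b" "k + 3 \<le> strands a x"
    and "same_colourings a (x @ shift k [cap 0] @ y) (x @ shift k [cap 1] @ y)"
  shows "interchangeable n a b (x @ shift k [cap 0] @ y) (x @ shift k [cap 1] @ y)"
proof -
  let ?T = "x @ shift k [cap 0] @ y" and ?T' = "x @ shift k [cap 1] @ y"
  let ?S = "x @ shift k [cup 3, cap 0, cap 0] @ y" and ?S' = "x @ shift k [cup 3, cap 1, cap 0] @ y"
  have b: "is_tangle a ?T' b"
    using assms(2,3) unfolding is_tangle_append[of a] by simp
  have TS: "interchangeable n a b ?T ?S"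
    using interchangeable_at[OF interchangeable_sym[OF extra_arc_left] assms(2,3)] .
  have TS': "interchangeable n a b ?T' ?S'"
    using interchangeable_at[OF interchangeable_sym[OF extra_arc_right] b assms(3)] .
  have "same_colourings a ?T ?S" "same_colourings a ?T' ?S'"
    using same_colourings_at[OF same_colourings_extra_arc(1)[THEN same_colourings_sym] assms(2,3)]
      same_colourings_at[OF same_colourings_extra_arc(2)[THEN same_colourings_sym] assms(2,3)] .
  then have "same_colourings a ?S ?S'"
    using assms(4) same_colourings_sym same_colourings_trans by blast
  moreover have "is_tangle a ?S b" "is_tangle a ?S' b"
    using TS TS' unfolding interchangeable_def by blast+
  ultimately have "interchangeable n a b ?S ?S'"
    using assms(1) by (intro H_smaller_interchangeable[where m = 2 and x = "x @ shift k [cup 3]" and k = k and y = y])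
      (auto simp: numeral_2_eq_2)
  then show ?thesis
    using TS TS' interchangeable_sym interchangeable_trans by blast
qed

text \<open>
  A maximum is at a different place than \<open>Y\<close> and can be raised past it.
\<close>

lemma cap_past:
  "is_tangle a Y b \<Longrightarrow> interchangeable n (2 + a) b (cap 0 # Y) (shift 2 Y @ [cap 0])"
proof (induction Y arbitrary: a)
  case Nil
  then show ?case by (simp add: interchangeable_refl)
next
  case (Cons l Y)
  obtain i p where l: "l = (i, p)" by (cases l)
  let ?a = "a - legs_below p + legs_above p"
  have a: "i + legs_below p \<le> a" and Y: "is_tangle ?a Y b" using Cons.prems by (auto simp: l)
  have a': "2 + a - legs_below p + legs_above p = 2 + ?a" using a by simp
  have "interchangeable n (2 + a) b (cap 0 # (i, p) # Y) ((2 + i, p) # cap 0 # Y)"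
    by (rule rewrite_at[OF exchange[of _ Cap i p, OF refl refl], of 0 _ 0]) (use a Y in auto)
  also have "interchangeable n (2 + a) b \<dots> ([(2 + i, p)] @ shift 0 (shift 2 Y @ [cap 0]) @ [])"
    using interchangeable_context[OF Cons.IH[OF Y], of "2 + a" "[(2 + i, p)]" 0 0 "[]" b] a a' by simp
  finally show ?case by (simp add: l numeral_2_eq_2)
qed

text \<open>
  Here \<open>Y\<close> is meant to be a tangle in which one strand starts and ends at the far left. An
  arc of this strand below \<open>Y\<close> and an arc above \<open>Y\<close> are both accessible on the left, and after a
  virtual half twist an \<open>H(2)\<close>-move at these arcs makes the strand run through \<open>Y\<close> in the opposite
  direction. The assumption on the colourings expresses that the strand indeed connects its bottom
  end to its top end within \<open>Y\<close>, so that the two smoothings have the same number of components.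
\<close>

lemma strand_reversal:
  assumes "2 \<le> n" "is_tangle (Suc a) Y (Suc b)"
    and "same_colourings (Suc a) ([cup 1, vi 0] @ shift 2 Y @ [cap 0]) ([cup 1, vi 0] @ shift 2 Y @ [cap 1])"
  shows "interchangeable n (Suc a) (Suc b) Y ([cup 0, vi 1] @ shift 2 Y @ [cap 1])"
proof -
  have Y: "is_tangle (Suc (Suc (Suc a))) (shift 2 Y) (Suc (Suc (Suc b)))"
    using is_tangle_shift[OF assms(2), of 2 0] by simp
  \<comment> \<open>A zigzag and a virtual kink at the bottom left produce the two arcs and the half twist.\<close>
  have "interchangeable n (Suc a) (Suc b) Y ([cup 1, cap 0] @ Y)"
    by (rule rewrite_at[OF zigzag_left[THEN interchangeable_sym], of 0 _ 0]) (use assms(2) in auto)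
  also have "interchangeable n (Suc a) (Suc b) \<dots> ([cup 1] @ shift 0 [vi 0, cap 0] @ Y)"
    using interchangeable_at[OF VR1_cap[THEN interchangeable_sym], of "Suc a" "[cup 1]" 0 Y] assms(2) by simp
  also have "interchangeable n (Suc a) (Suc b) \<dots> ([cup 1, vi 0] @ shift 2 Y @ shift 0 [cap 0] @ [])"
    using interchangeable_context[OF cap_past[OF assms(2)], of "Suc a" "[cup 1, vi 0]" 0 0 "[]"]
    by (simp add: numeral_2_eq_2)
  also have "interchangeable n (Suc a) (Suc b) \<dots> ([cup 1, vi 0] @ shift 2 Y @ shift 0 [cap 1] @ [])"
    using smoothing[of n "Suc a" "[cup 1, vi 0] @ shift 2 Y" 0 "[]" "Suc b"] assms(1,3) Y is_tangle_strands[OF Y]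
    by (simp add: is_tangle_append)
  also have "interchangeable n (Suc a) (Suc b) \<dots> ([cup 0, vi 1] @ shift 2 Y @ [cap 1])"
    using interchangeable_at[OF cup_slide[of _ Virtual, THEN interchangeable_sym], of "Suc a" "[]" 0 "shift 2 Y @ [cap 1]" "Suc b"]
      is_tangle_appendI[OF Y, of "[cap 1]"] by simp
  finally show ?thesis by simp
qed

text \<open>
  The strand that passes under the other one in \<open>un 0\<close> returns to the left by \<open>vi 0\<close>, and this loop
  is reversed. The curl that the reversal produces is pulled straight, partly by virtual moves, and
  the strand first crosses virtually and then returns under the other one.
\<close>

lemma reverse_under_one:
  assumes "2 \<le> n"
  shows "interchangeable n 2 2 [un 0, vi 0] [vi 0, ov 0]"
proof -
  have "interchangeable n 2 2 [un 0, vi 0] [cup 0, vi 1, un 2, vi 2, cap 1]"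
  proof -
    have "same_colourings 2 [cup 1, vi 0, un 2, vi 2, cap 0] [cup 1, vi 0, un 2, vi 2, cap 1]"
      by (rule same_colourings_2I; simp add: colourings_shift_Cons del: shift_simps(2))
    then show ?thesis
      using strand_reversal[OF assms, of 1 "[un 0, vi 0]" 1] by (simp add: numeral_2_eq_2)
  qed
  also have "interchangeable n 2 2 \<dots> [cup 0, vi 1, un 2, vi 1, cap 2]"
    by (rule rewrite_at[OF cap_slide[of _ Virtual], of 3 _ 1]; simp)
  also have "interchangeable n 2 2 \<dots> [cup 0, vi 2, un 1, vi 2, cap 2]"
    by (rule rewrite_at[OF VR4_2[of Under], of 1 _ 1]; simp)
  also have "interchangeable n 2 2 \<dots> [cup 0, vi 2, un 1, cap 2]"
    by (rule rewrite_at[OF VR1_cap, of 3 _ 2]; simp)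
  also have "interchangeable n 2 2 \<dots> [vi 0, cup 0, un 1, cap 2]"
    by (rule rewrite_at[OF exchange[of _ Cup 0 "Cross Virtual", OF refl refl], of 0 _ 0]; simp)
  also have "interchangeable n 2 2 \<dots> [vi 0, cup 1, ov 0, cap 2]"
    by (rule rewrite_at[OF cup_slide[of _ Under], of 1 _ 0]; simp)
  also have "interchangeable n 2 2 \<dots> [vi 0, cup 1, cap 2, ov 0]"
    by (rule rewrite_at[OF exchange[of _ "Cross Over" 0 Cap, OF refl refl], of 2 _ 0]; simp)
  also have "interchangeable n 2 2 \<dots> [vi 0, ov 0]"
    by (rule rewrite_at[OF zigzag_right, of 1 _ 1]; simp)
  finally show ?thesis .
qed

text \<open>
  The same for a loop that passes under two strands. Reversal exchanges the order in which the two
  undercrossings are met.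
\<close>

lemma reverse_under_two:
  assumes "2 \<le> n"
  shows "interchangeable n 3 3 [un 0, un 1, vi 1, vi 0] [vi 0, vi 1, ov 1, ov 0]"
proof -
  have "interchangeable n 3 3 [un 0, un 1, vi 1, vi 0] [cup 0, vi 1, un 2, un 3, vi 3, vi 2, cap 1]"
  proof -
    have "same_colourings 3 [cup 1, vi 0, un 2, un 3, vi 3, vi 2, cap 0]
        [cup 1, vi 0, un 2, un 3, vi 3, vi 2, cap 1]"
      by (rule same_colourings_3I; simp add: colourings_shift_Cons del: shift_simps(2))
    then show ?thesis
      using strand_reversal[OF assms, of 2 "[un 0, un 1, vi 1, vi 0]" 2] by (simp add: eval_nat_numeral)
  qed
  also have "interchangeable n 3 3 \<dots> [cup 0, vi 1, un 2, un 3, vi 3, vi 1, cap 2]"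
    by (rule rewrite_at[OF cap_slide[of _ Virtual], of 5 _ 1]; simp)
  also have "interchangeable n 3 3 \<dots> [cup 0, vi 1, un 2, un 3, vi 1, vi 3, cap 2]"
    by (rule rewrite_at[OF exchange[of _ "Cross Virtual" 0 "Cross Virtual", OF refl refl, THEN interchangeable_sym], of 4 _ 1]; simp)
  also have "interchangeable n 3 3 \<dots> [cup 0, vi 1, un 2, vi 1, un 3, vi 3, cap 2]"
    by (rule rewrite_at[OF exchange[of _ "Cross Virtual" 0 "Cross Under", OF refl refl, THEN interchangeable_sym], of 3 _ 1]; simp)
  also have "interchangeable n 3 3 \<dots> [cup 0, vi 1, un 2, vi 1, un 3, vi 2, cap 3]"
    by (rule rewrite_at[OF cap_slide[of _ Virtual], of 5 _ 2]; simp)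
  also have "interchangeable n 3 3 \<dots> [cup 0, vi 2, un 1, vi 2, un 3, vi 2, cap 3]"
    by (rule rewrite_at[OF VR4_2[of Under], of 1 _ 1]; simp)
  also have "interchangeable n 3 3 \<dots> [cup 0, vi 2, un 1, vi 3, un 2, vi 3, cap 3]"
    by (rule rewrite_at[OF VR4_2[of Under], of 3 _ 2]; simp)
  also have "interchangeable n 3 3 \<dots> [cup 0, vi 2, un 1, vi 3, un 2, cap 3]"
    by (rule rewrite_at[OF VR1_cap, of 5 _ 3]; simp)
  also have "interchangeable n 3 3 \<dots> [cup 0, vi 2, vi 3, un 1, un 2, cap 3]"
    by (rule rewrite_at[OF exchange[of _ "Cross Under" 0 "Cross Virtual", OF refl refl], of 2 _ 1]; simp)
  also have "interchangeable n 3 3 \<dots> [vi 0, cup 0, vi 3, un 1, un 2, cap 3]"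
    by (rule rewrite_at[OF exchange[of _ Cup 0 "Cross Virtual", OF refl refl], of 0 _ 0]; simp)
  also have "interchangeable n 3 3 \<dots> [vi 0, vi 1, cup 0, un 1, un 2, cap 3]"
    by (rule rewrite_at[OF exchange[of _ Cup 1 "Cross Virtual", OF refl refl], of 1 _ 0]; simp)
  also have "interchangeable n 3 3 \<dots> [vi 0, vi 1, cup 1, ov 0, un 2, cap 3]"
    by (rule rewrite_at[OF cup_slide[of _ Under], of 2 _ 0]; simp)
  also have "interchangeable n 3 3 \<dots> [vi 0, vi 1, cup 1, un 2, ov 0, cap 3]"
    by (rule rewrite_at[OF exchange[of _ "Cross Over" 0 "Cross Under", OF refl refl], of 3 _ 0]; simp)
  also have "interchangeable n 3 3 \<dots> [vi 0, vi 1, cup 2, ov 1, ov 0, cap 3]"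
    by (rule rewrite_at[OF cup_slide[of _ Under], of 2 _ 1]; simp)
  also have "interchangeable n 3 3 \<dots> [vi 0, vi 1, cup 2, ov 1, cap 3, ov 0]"
    by (rule rewrite_at[OF exchange[of _ "Cross Over" 1 Cap, OF refl refl], of 4 _ 0]; simp)
  also have "interchangeable n 3 3 \<dots> [vi 0, vi 1, cup 2, cap 3, ov 1, ov 0]"
    by (rule rewrite_at[OF exchange[of _ "Cross Over" 0 Cap, OF refl refl], of 3 _ 1]; simp)
  also have "interchangeable n 3 3 \<dots> [vi 0, vi 1, ov 1, ov 0]"
    by (rule rewrite_at[OF zigzag_right, of 2 _ 2]; simp)
  finally show ?thesis .
qed

section \<open>Exchanging two undercrossings\<close>

text \<open>
  In \<open>ov 0\<close> the strand that passes under runs to the left. So its undercrossing is that of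
  \<open>un 0\<close> traversed in the opposite direction, up to virtual crossings.
\<close>

lemma over_via_under:
  assumes "2 \<le> n"
  shows "interchangeable n 2 2 [ov 0] [vi 0, un 0, vi 0]"
proof -
  have "interchangeable n 2 2 [ov 0] [vi 0, vi 0, ov 0]"
    by (rule rewrite_at[OF VR2[THEN interchangeable_sym], of 0 _ 0]; simp)
  also have "interchangeable n 2 2 \<dots> [vi 0, un 0, vi 0]"
    by (rule rewrite_at[OF reverse_under_one[OF assms, THEN interchangeable_sym], of 1 _ 0]; simp)
  finally show ?thesis .
qed

text \<open>
  The two undercrossings are first reversed together and then one by one, which restores their
  directions but leaves them in the opposite order. The rest of the calculation is the removal of
  superfluous virtual crossings.
\<close>

lemma F_U_strand1:
  assumes "2 \<le> n"
  shows "interchangeable n 3 3 [un 0, un 1, vi 0] [vi 1, un 0, un 1]"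
proof -
  note over = over_via_under[OF assms]
  have "interchangeable n 3 3 [un 0, un 1, vi 0] [un 0, un 1, vi 1, vi 1, vi 0]"
    by (rule rewrite_at[OF VR2[THEN interchangeable_sym], of 2 _ 1]; simp)
  also have "interchangeable n 3 3 \<dots> [un 0, un 1, vi 1, vi 0, vi 0, vi 1, vi 0]"
    by (rule rewrite_at[OF VR2[THEN interchangeable_sym], of 3 _ 0]; simp)
  also have "interchangeable n 3 3 \<dots> [vi 0, vi 1, ov 1, ov 0, vi 0, vi 1, vi 0]"
    by (rule rewrite_at[OF reverse_under_two[OF assms], of 0 _ 0]; simp)
  also have "interchangeable n 3 3 \<dots> [vi 0, vi 1, vi 1, un 1, vi 1, ov 0, vi 0, vi 1, vi 0]"
    by (rule rewrite_at[OF over, of 2 _ 1]; simp)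
  also have "interchangeable n 3 3 \<dots> [vi 0, un 1, vi 1, ov 0, vi 0, vi 1, vi 0]"
    by (rule rewrite_at[OF VR2, of 1 _ 1]; simp)
  also have "interchangeable n 3 3 \<dots> [vi 0, un 1, vi 1, vi 0, un 0, vi 0, vi 0, vi 1, vi 0]"
    by (rule rewrite_at[OF over, of 3 _ 0]; simp)
  also have "interchangeable n 3 3 \<dots> [vi 0, un 1, vi 1, vi 0, un 0, vi 1, vi 0]"
    by (rule rewrite_at[OF VR2, of 5 _ 0]; simp)
  also have "interchangeable n 3 3 \<dots> [vi 1, vi 1, vi 0, un 1, vi 1, vi 0, un 0, vi 1, vi 0]"
    by (rule rewrite_at[OF VR2[THEN interchangeable_sym], of 0 _ 1]; simp)
  also have "interchangeable n 3 3 \<dots> [vi 1, un 0, vi 1, vi 0, vi 1, vi 0, un 0, vi 1, vi 0]"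
    by (rule rewrite_at[OF VR4_3[of Under, THEN interchangeable_sym], of 1 _ 0]; simp)
  also have "interchangeable n 3 3 \<dots> [vi 1, un 0, vi 1, vi 1, vi 0, vi 1, un 0, vi 1, vi 0]"
    by (rule rewrite_at[OF VR3, of 3 _ 0]; simp)
  also have "interchangeable n 3 3 \<dots> [vi 1, un 0, vi 0, vi 1, un 0, vi 1, vi 0]"
    by (rule rewrite_at[OF VR2, of 2 _ 1]; simp)
  also have "interchangeable n 3 3 \<dots> [vi 1, un 0, un 1, vi 0, vi 1, vi 1, vi 0]"
    by (rule rewrite_at[OF VR4_1[of Under], of 2 _ 0]; simp)
  also have "interchangeable n 3 3 \<dots> [vi 1, un 0, un 1, vi 0, vi 0]"
    by (rule rewrite_at[OF VR2, of 4 _ 1]; simp)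
  also have "interchangeable n 3 3 \<dots> [vi 1, un 0, un 1]"
    by (rule rewrite_at[OF VR2, of 3 _ 0]; simp)
  finally show ?thesis .
qed

text \<open>
  If the strand that passes under is the second or the third one, each \<open>ov\<close> is written as a
  conjugate of \<open>un\<close> by virtual crossings, and the mixed moves reduce the claim to the first case.
\<close>

lemma F_U_strand2:
  assumes "2 \<le> n"
  shows "interchangeable n 3 3 [ov 0, vi 1, un 0] [un 1, vi 0, ov 1]"
proof -
  note over = over_via_under[OF assms]
  have "interchangeable n 3 3 [ov 0, vi 1, un 0] [vi 0, un 0, vi 0, vi 1, un 0]"
    by (rule rewrite_at[OF over, of 0 _ 0]; simp)
  also have "interchangeable n 3 3 \<dots> [vi 0, un 0, un 1, vi 0, vi 1]"
    by (rule rewrite_at[OF VR4_1[of Under], of 2 _ 0]; simp)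
  also have "interchangeable n 3 3 \<dots> [vi 0, vi 1, un 0, un 1, vi 1]"
    by (rule rewrite_at[OF F_U_strand1[OF assms], of 1 _ 0]; simp)
  also have "interchangeable n 3 3 \<dots> [un 1, vi 0, vi 1, un 1, vi 1]"
    by (rule rewrite_at[OF VR4_1[of Under], of 0 _ 0]; simp)
  also have "interchangeable n 3 3 \<dots> [un 1, vi 0, ov 1]"
    by (rule rewrite_at[OF over[THEN interchangeable_sym], of 2 _ 1]; simp)
  finally show ?thesis .
qed

text \<open>
  Conjugation by the virtual half twist on three strands exchanges the under-strand on the right
  with one on the left.
\<close>

lemma over_over_via_under:
  assumes "2 \<le> n"
  shows "interchangeable n 3 3 [ov 1, ov 0] [vi 1, vi 0, vi 1, un 0, un 1, vi 0, vi 1, vi 0]"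
proof -
  note over = over_via_under[OF assms]
  have "interchangeable n 3 3 [ov 1, ov 0] [vi 1, un 1, vi 1, ov 0]"
    by (rule rewrite_at[OF over, of 0 _ 1]; simp)
  also have "interchangeable n 3 3 \<dots> [vi 1, un 1, vi 1, vi 0, un 0, vi 0]"
    by (rule rewrite_at[OF over, of 3 _ 0]; simp)
  also have "interchangeable n 3 3 \<dots> [vi 1, vi 0, vi 0, un 1, vi 1, vi 0, un 0, vi 0]"
    by (rule rewrite_at[OF VR2[THEN interchangeable_sym], of 1 _ 0]; simp)
  also have "interchangeable n 3 3 \<dots> [vi 1, vi 0, vi 1, vi 1, vi 0, un 1, vi 1, vi 0, un 0, vi 0]"
    by (rule rewrite_at[OF VR2[THEN interchangeable_sym], of 2 _ 1]; simp)
  also have "interchangeable n 3 3 \<dots> [vi 1, vi 0, vi 1, un 0, vi 1, vi 0, vi 1, vi 0, un 0, vi 0]"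
    by (rule rewrite_at[OF VR4_3[of Under, THEN interchangeable_sym], of 3 _ 0]; simp)
  also have "interchangeable n 3 3 \<dots> [vi 1, vi 0, vi 1, un 0, vi 1, vi 1, vi 0, vi 1, un 0, vi 0]"
    by (rule rewrite_at[OF VR3, of 5 _ 0]; simp)
  also have "interchangeable n 3 3 \<dots> [vi 1, vi 0, vi 1, un 0, vi 0, vi 1, un 0, vi 0]"
    by (rule rewrite_at[OF VR2, of 4 _ 1]; simp)
  also have "interchangeable n 3 3 \<dots> [vi 1, vi 0, vi 1, un 0, un 1, vi 0, vi 1, vi 0]"
    by (rule rewrite_at[OF VR4_1[of Under], of 4 _ 0]; simp)
  finally show ?thesis .
qed

lemma F_U_strand3:
  assumes "2 \<le> n"
  shows "interchangeable n 3 3 [vi 0, ov 1, ov 0] [ov 1, ov 0, vi 1]"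
proof -
  note over = over_over_via_under[OF assms]
  have "interchangeable n 3 3 [vi 0, ov 1, ov 0] [vi 0, vi 1, vi 0, vi 1, un 0, un 1, vi 0, vi 1, vi 0]"
    by (rule rewrite_at[OF over, of 1 _ 0]; simp)
  also have "interchangeable n 3 3 \<dots> [vi 1, vi 0, vi 1, vi 1, un 0, un 1, vi 0, vi 1, vi 0]"
    by (rule rewrite_at[OF VR3, of 0 _ 0]; simp)
  also have "interchangeable n 3 3 \<dots> [vi 1, vi 0, vi 1, vi 1, un 0, un 1, vi 1, vi 0, vi 1]"
    by (rule rewrite_at[OF VR3, of 6 _ 0]; simp)
  also have "interchangeable n 3 3 \<dots> [vi 1, vi 0, vi 1, un 0, un 1, vi 0, vi 1, vi 0, vi 1]"
    by (rule rewrite_at[OF F_U_strand1[OF assms, THEN interchangeable_sym], of 3 _ 0]; simp)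
  also have "interchangeable n 3 3 \<dots> [ov 1, ov 0, vi 1]"
    by (rule rewrite_at[OF over[THEN interchangeable_sym], of 0 _ 0]; simp)
  finally show ?thesis .
qed

lemma F_U_interchangeable:
  assumes "2 \<le> n" "F_U_rule T T'"
  shows "interchangeable n 3 3 T T'"
  using assms(2)
  by cases (use F_U_strand1 F_U_strand2 F_U_strand3 assms(1) in \<open>auto simp: triangle_def triangle'_def\<close>)

theorem theorem2p2:
  fixes n :: nat and W W' :: link_diagram
  assumes "n \<ge> 2"
    and "F_U_move W W'"
  shows "(\<lambda>D D'. H_move n D D' \<or> welded_move D D')\<^sup>*\<^sup>* W W'"
proof -
  obtain u v k T T' where W: "W = abs_link_diagram (u @ shift k T @ v)" "W' = abs_link_diagram (u @ shift k T' @ v)"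
    and link: "link_word (u @ shift k T @ v)" and rule: "F_U_rule T T' \<or> F_U_rule T' T"
    using assms(2) unfolding F_U_move_def diagram_move_def local_step_def by blast
  have TT': "interchangeable n 3 3 T T'"
    using rule F_U_interchangeable assms(1) interchangeable_sym by blast
  \<comment> \<open>On either side of the rule the pieces have legs on all three strands of the disk.\<close>
  have "k + 3 \<le> strands 0 u"
    using rule link unfolding link_word_def is_tangle_append[of 0]
    by (auto elim!: F_U_rule.cases simp: triangle_def triangle'_def)
  then have "interchangeable n 0 0 (u @ shift k T @ v) (u @ shift k T' @ v)"
    using interchangeable_at[OF TT'] link unfolding link_word_def by blast
  from this[unfolded interchangeable_def, THEN conjunct2, THEN conjunct2, rule_format, of "[]" 0 0 "[]"]
  have "(elementary_move n)\<^sup>*\<^sup>* (u @ shift k T @ v) (u @ shift k T' @ v)" by simp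
  then show ?thesis
    unfolding W by (rule elementary_moves_abs)
qed

end
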